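(* $\mathsf{RT}^1_5\not\le_\mathrm{W}\mathsf{ADS}$. Therefore $\mathsf{RT}^1_{<\infty}\not\le_\mathrm{W}\mathsf{ADS}$.
   Context: Problems are multi-valued partial functions $\subseteq\omega^\omega\rightrightarrows\omega^\omega$ with standard codings. $\mathcal{F}\le_\mathrm{W}\mathcal{G}$ if there are Turing functionals $\Phi,\Psi$ with $\Phi(f)\in\mathrm{dom}(\mathcal{G})$ for all $f\in\mathrm{dom}(\mathcal{F})$ and $\Psi(\langle f,g\rangle)\in\mathcal{F}(f)$ for all $f\in\mathrm{dom}(\mathcal F)$, $g\in\mathcal{G}(\Phi(f))$. $\mathsf{RT}^1_5$: input $c\colon\omega\to\{0,\dots,4\}$; output an infinite $H$ on which $c$ is constant. $\mathsf{RT}^1_{<\infty}$: input $c\colon\omega\to\omega$ with finite range; output an infinite $H$ on which $c$ is constant. $\mathsf{ADS}$: input an infinite linear order $(L,<_L)$ with $L\subseteq\omega$; output an infinite $S\subseteq L$ that is an ascending sequence ($\forall x,y\in S$, $x<y\to x<_Ly$) or a descending sequence ($\forall x,y\in S$, $x<y\to y<_Lx$). *)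

theory Defs
  imports "HOL-Library.Nat_Bijection" "HOL-Library.Ramsey"
begin

type_synonym baire = "nat \<Rightarrow> nat"


section \<open>Turing functionals\<close>

text \<open>
  Partial recursive functions relative to an oracle, in Kleene's presentation: the schemes for
  partial recursive functions together with one scheme that queries the oracle.
\<close>

datatype prog =
    Zero
  | Succ
  | Oracle
  | Proj nat
  | Comp prog "prog list"
  | PrimRec prog prog
  | Mu prog

inductive computes :: "baire \<Rightarrow> prog \<Rightarrow> nat list \<Rightarrow> nat \<Rightarrow> bool" for f :: baire where
  Zero: "computes f Zero xs 0"
| Succ: "computes f Succ [x] (Suc x)"
| Oracle: "computes f Oracle [x] (f x)"
| Proj: "i < length xs \<Longrightarrow> computes f (Proj i) xs (xs ! i)"
| Comp: "list_all2 (\<lambda>q y. computes f q xs y) qs ys \<Longrightarrow> computes f p ys z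
    \<Longrightarrow> computes f (Comp p qs) xs z"
| PrimRec_0: "computes f p xs y \<Longrightarrow> computes f (PrimRec p q) (0 # xs) y"
| PrimRec_Suc: "computes f (PrimRec p q) (n # xs) y \<Longrightarrow> computes f q (n # y # xs) z
    \<Longrightarrow> computes f (PrimRec p q) (Suc n # xs) z"
| Mu: "computes f p (n # xs) 0 \<Longrightarrow> (\<forall>m<n. \<exists>y. computes f p (m # xs) (Suc y))
    \<Longrightarrow> computes f (Mu p) xs n"

text \<open>
  A program \<open>p\<close> induces the partial functional that is defined at \<open>f\<close> iff \<open>p\<close> with oracle \<open>f\<close> halts
  on every input \<open>n\<close>, its value being the total function so computed.
\<close>

definition turing_functional :: "(baire \<Rightarrow> baire option) \<Rightarrow> bool" where
  "turing_functional \<Phi> \<longleftrightarrow>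
     (\<exists>p. \<forall>f g. \<Phi> f = Some g \<longleftrightarrow> (\<forall>n. computes f p [n] (g n)))"

inductive_cases computes_ZeroE: "computes f Zero xs z"
inductive_cases computes_SuccE: "computes f Succ xs z"
inductive_cases computes_OracleE: "computes f Oracle xs z"
inductive_cases computes_ProjE: "computes f (Proj i) xs z"
inductive_cases computes_CompE: "computes f (Comp p qs) xs z"
inductive_cases computes_PrimRec_0E: "computes f (PrimRec p q) (0 # xs) z"
inductive_cases computes_PrimRec_SucE: "computes f (PrimRec p q) (Suc n # xs) z"
inductive_cases computes_MuE: "computes f (Mu p) xs z"

lemma computes_deterministic:
  "computes f p xs y \<Longrightarrow> computes f p xs z \<Longrightarrow> y = z"
proof (induction arbitrary: z rule: computes.induct)
  case (Zero xs)
  then show ?case by (elim computes_ZeroE) simp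
next
  case (Succ x)
  then show ?case by (elim computes_SuccE) simp
next
  case (Oracle x)
  then show ?case by (elim computes_OracleE) simp
next
  case (Proj i xs)
  from Proj.prems show ?case by (elim computes_ProjE) simp
next
  case (Comp xs qs ys p z')
  from Comp.prems obtain ys' where l: "list_all2 (\<lambda>q y. computes f q xs y) qs ys'" and z: "computes f p ys' z"
    by (elim computes_CompE) blast
  have len: "length qs = length ys" "length qs = length ys'"
    using list_all2_lengthD[OF Comp.IH(1)] list_all2_lengthD[OF l] .
  have "ys ! i = ys' ! i" if "i < length ys" for i
  proof -
    have i: "i < length qs" using that len by simp
    show ?thesis using list_all2_nthD[OF Comp.IH(1) i] list_all2_nthD[OF l i] by blast
  qed
  with len have "ys = ys'" by (intro nth_equalityI) auto
  with z Comp.IH(2) show ?case by simp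
next
  case (PrimRec_0 p xs y q)
  from PrimRec_0.prems have "computes f p xs z" by (elim computes_PrimRec_0E)
  then show ?case by (rule PrimRec_0.IH)
next
  case (PrimRec_Suc p q n xs y z')
  from PrimRec_Suc.prems obtain y' where y': "computes f (PrimRec p q) (n # xs) y'"
    and z: "computes f q (n # y' # xs) z"
    by (elim computes_PrimRec_SucE)
  from PrimRec_Suc.IH(1)[OF y'] z show ?case by (intro PrimRec_Suc.IH(2)) simp
next
  case (Mu p n xs)
  from Mu.prems obtain 0: "computes f p (z # xs) 0"
    and less: "\<forall>m<z. \<exists>y. computes f p (m # xs) (Suc y)"
    by (elim computes_MuE) blast
  have "\<not> n < z" using Mu.IH(1) less by (metis nat.distinct(1))
  moreover have "\<not> z < n" using Mu.IH(2) 0 by (metis nat.distinct(1))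
  ultimately show ?case by simp
qed

lemma turing_functional_exists:
  "\<exists>\<Phi>. \<forall>f g. \<Phi> f = Some g \<longleftrightarrow> (\<forall>n. computes f p [n] (g n))"
proof -
  have uniq: "g = g'" if "\<forall>n. computes f p [n] (g n)" "\<forall>n. computes f p [n] (g' n)" for f g g'
    using that by (intro ext computes_deterministic[of f p]) auto
  show ?thesis
  proof (intro exI allI)
    fix f g
    show "(if \<exists>g. \<forall>n. computes f p [n] (g n)
        then Some (SOME g. \<forall>n. computes f p [n] (g n)) else None) = Some g
      \<longleftrightarrow> (\<forall>n. computes f p [n] (g n))"
    proof (cases "\<exists>g. \<forall>n. computes f p [n] (g n)")
      case True
      have "\<forall>n. computes f p [n] ((SOME g. \<forall>n. computes f p [n] (g n)) n)"
        using True by (rule someI_ex)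
      with True uniq show ?thesis by auto
    qed auto
  qed
qed


section \<open>Problems and Weihrauch reducibility\<close>

type_synonym problem = "baire \<Rightarrow> baire set"

definition dom_of :: "problem \<Rightarrow> baire set" where
  "dom_of F = {f. F f \<noteq> {}}"

definition join :: "baire \<Rightarrow> baire \<Rightarrow> baire" where
  "join f g n = (if even n then f (n div 2) else g (n div 2))"

definition weihrauch_le :: "problem \<Rightarrow> problem \<Rightarrow> bool" (infix "\<le>\<^sub>W" 50) where
  "F \<le>\<^sub>W G \<longleftrightarrow>
     (\<exists>\<Phi> \<Psi>. turing_functional \<Phi> \<and> turing_functional \<Psi> \<and>
        (\<forall>f \<in> dom_of F. \<exists>h \<in> dom_of G. \<Phi> f = Some h) \<and>
        (\<forall>f \<in> dom_of F. \<forall>g \<in> G (the (\<Phi> f)). \<exists>k \<in> F f. \<Psi> (join f g) = Some k))"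


section \<open>The problems\<close>

definition char_fun :: "nat set \<Rightarrow> baire" where
  "char_fun A n = (if n \<in> A then 1 else 0)"

definition RT1 :: "nat \<Rightarrow> problem" where
  "RT1 k c = {char_fun H | H. range c \<subseteq> {..<k} \<and> infinite H \<and> (\<exists>i. \<forall>x\<in>H. c x = i)}"

definition RT1_finite :: problem where
  "RT1_finite c = {char_fun H | H. finite (range c) \<and> infinite H \<and> (\<exists>i. \<forall>x\<in>H. c x = i)}"

definition infinite_linear_order :: "nat set \<Rightarrow> (nat \<times> nat) set \<Rightarrow> bool" where
  "infinite_linear_order L R \<longleftrightarrow> infinite L \<and> R \<subseteq> L \<times> L \<and> strict_linear_order_on L R"

definition code_order :: "nat set \<Rightarrow> (nat \<times> nat) set \<Rightarrow> baire" where
  "code_order L R = join (char_fun L) (char_fun (prod_encode ` R))"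

definition ascending :: "(nat \<times> nat) set \<Rightarrow> nat set \<Rightarrow> bool" where
  "ascending R S \<longleftrightarrow> (\<forall>x\<in>S. \<forall>y\<in>S. x < y \<longrightarrow> (x, y) \<in> R)"

definition descending :: "(nat \<times> nat) set \<Rightarrow> nat set \<Rightarrow> bool" where
  "descending R S \<longleftrightarrow> (\<forall>x\<in>S. \<forall>y\<in>S. x < y \<longrightarrow> (y, x) \<in> R)"

definition ADS :: problem where
  "ADS f = {char_fun S | S L R. f = code_order L R \<and> infinite_linear_order L R \<and>
     S \<subseteq> L \<and> infinite S \<and> (ascending R S \<or> descending R S)}"

text \<open>
  Every intended instance has a solution, so the domain of each problem is its set of instances,
  and an instance of \<open>ADS\<close> codes only one linear order.
\<close>

lemma infinite_fibre:
  fixes c :: baire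
  assumes "finite (range c)"
  obtains H i where "infinite H" and "\<forall>x\<in>H. c x = i"
proof -
  have "\<exists>i\<in>UNIV. infinite {x \<in> UNIV. c x = c i}"
    using infinite_UNIV_nat assms by (rule pigeonhole_infinite)
  then obtain i where "infinite {x. c x = c i}" by auto
  then show thesis using that by blast
qed

lemma dom_of_RT1: "dom_of (RT1 k) = {c. range c \<subseteq> {..<k}}"
proof (intro set_eqI iffI)
  fix c :: baire assume "c \<in> {c. range c \<subseteq> {..<k}}"
  then have c: "range c \<subseteq> {..<k}" by simp
  then have "finite (range c)" by (rule finite_subset) simp
  then obtain H i where "infinite H" "\<forall>x\<in>H. c x = i" by (rule infinite_fibre)
  with c have "char_fun H \<in> RT1 k c" unfolding RT1_def by blast
  then show "c \<in> dom_of (RT1 k)" unfolding dom_of_def by blast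
qed (auto simp: dom_of_def RT1_def)

lemma dom_of_RT1_finite: "dom_of RT1_finite = {c. finite (range c)}"
proof (intro set_eqI iffI)
  fix c :: baire assume "c \<in> {c. finite (range c)}"
  then have c: "finite (range c)" by simp
  then obtain H i where "infinite H" "\<forall>x\<in>H. c x = i" by (rule infinite_fibre)
  with c have "char_fun H \<in> RT1_finite c" unfolding RT1_finite_def by blast
  then show "c \<in> dom_of RT1_finite" unfolding dom_of_def by blast
qed (auto simp: dom_of_def RT1_finite_def)

lemma join_inject: "join f g = join f' g' \<longleftrightarrow> f = f' \<and> g = g'"
proof
  assume eq: "join f g = join f' g'"
  have "f n = f' n" for n using fun_cong[OF eq, of "2 * n"] by (simp add: join_def)
  moreover have "g n = g' n" for n using fun_cong[OF eq, of "2 * n + 1"] by (simp add: join_def)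
  ultimately show "f = f' \<and> g = g'" by blast
qed simp

lemma char_fun_inject: "char_fun A = char_fun B \<longleftrightarrow> A = B"
proof
  assume eq: "char_fun A = char_fun B"
  have "n \<in> A \<longleftrightarrow> n \<in> B" for n
    using fun_cong[OF eq, of n] by (simp add: char_fun_def split: if_splits)
  then show "A = B" by blast
qed simp

lemma code_order_inject: "code_order L R = code_order L' R' \<longleftrightarrow> L = L' \<and> R = R'"
  by (simp add: code_order_def join_inject char_fun_inject inj_image_eq_iff[OF inj_prod_encode])

lemma ADS_solvable:
  assumes "infinite_linear_order L R"
  shows "\<exists>S\<subseteq>L. infinite S \<and> (ascending R S \<or> descending R S)"
proof -
  define col :: "nat set \<Rightarrow> nat" where "col X = (if (Min X, Max X) \<in> R then 0 else 1)" for X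
  have "infinite L" and tot: "total_on L R"
    using assms by (auto simp: infinite_linear_order_def strict_linear_order_on_def)
  have "\<forall>x\<in>L. \<forall>y\<in>L. x \<noteq> y \<longrightarrow> col {x, y} < 2"
    by (simp add: col_def)
  from Ramsey2[OF \<open>infinite L\<close> this] obtain S t where S: "S \<subseteq> L" "infinite S"
    and hom: "\<forall>x\<in>S. \<forall>y\<in>S. x \<noteq> y \<longrightarrow> col {x, y} = t"
    by blast
  have col: "col {x, y} = (if (x, y) \<in> R then 0 else 1)" if "x < y" for x y
    using that by (simp add: col_def)
  have "ascending R S \<or> descending R S"
  proof (cases "t = 0")
    case True
    then have "ascending R S"
      unfolding ascending_def using hom col by (metis less_irrefl zero_neq_one)
    then show ?thesis ..
  next
    case False
    then have "(x, y) \<notin> R" if "x \<in> S" "y \<in> S" "x < y" for x y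
      using hom col that by (metis less_irrefl)
    then have "descending R S"
      unfolding descending_def using tot S(1) by (metis less_irrefl subsetD total_on_def)
    then show ?thesis ..
  qed
  with S show ?thesis by blast
qed

lemma dom_of_ADS: "dom_of ADS = {code_order L R | L R. infinite_linear_order L R}"
proof (intro set_eqI iffI)
  fix f assume "f \<in> {code_order L R | L R. infinite_linear_order L R}"
  then obtain L R where f: "f = code_order L R" and LR: "infinite_linear_order L R" by blast
  from ADS_solvable[OF LR] obtain S where "S \<subseteq> L" "infinite S"
    "ascending R S \<or> descending R S" by blast
  with f LR have "char_fun S \<in> ADS f" unfolding ADS_def by blast
  then show "f \<in> dom_of ADS" unfolding dom_of_def by blast
qed (auto simp: dom_of_def ADS_def)

end

theory Submission
  imports Defs
begin

text \<open>
  Suppose functionals \<open>\<Phi>\<close>, \<open>\<Psi>\<close> witness the reduction, let \<open>(L\<^sub>c, R\<^sub>c)\<close> be the order coded by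
  \<open>\<Phi>(c)\<close>, and consider colourings \<open>c\<close> that extend a fixed finite string and take all further values
  in a fixed set \<open>A\<close> of colours. By continuity, along an infinite ascending sequence the functional
  \<open>\<Psi>\<close> eventually puts some number of colour \<open>i\<close> into its output; the last element \<open>x\<close> read so far
  is then \<^emph>\<open>committed\<close> to \<open>i\<close>: if the colouring is continued without using \<open>i\<close>, no infinite
  ascending sequence lies above \<open>x\<close>. The same holds for descending sequences.

  Repeatedly committing and then avoiding the colour just committed to yields elements
  \<open>x\<^sub>0 > x\<^sub>1 > \<dots>\<close>, each committed for ascending sequences, as long as ascending sequences exist
  whenever one colour of \<open>A\<close> is dropped. The dual construction shows that ascending sequences exist
  as soon as \<open>A\<close> has two colours. So with all five colours there is such a chain; it is
  a descending sequence, hence one of its elements \<open>y\<close> is committed for descending sequences to some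
  colour \<open>b\<close>, and the next element \<open>x < y\<close> is committed for ascending sequences to some \<open>a\<close>. Drop \<open>a\<close>
  and \<open>b\<close> and run the construction with the remaining three colours, starting from \<open>x\<close>: this gives
  a descending sequence below \<open>y\<close> although \<open>b\<close> is no longer used, a contradiction.
\<close>

section \<open>Continuity of Turing functionals\<close>

definition agree :: "nat \<Rightarrow> baire \<Rightarrow> baire \<Rightarrow> bool" where
  "agree N f g \<longleftrightarrow> (\<forall>m<N. f m = g m)"

lemma agree_refl [simp]: "agree N f f"
  by (simp add: agree_def)

lemma agree_mono: "agree N f g \<Longrightarrow> M \<le> N \<Longrightarrow> agree M f g"
  by (auto simp: agree_def)

lemma agree_trans: "agree N f g \<Longrightarrow> agree N g h \<Longrightarrow> agree N f h"
  by (auto simp: agree_def)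

lemma finite_uniform_agree_bound:
  assumes "finite X" and "\<forall>x\<in>X. \<exists>N. \<forall>g. agree N f g \<longrightarrow> P x g"
  shows "\<exists>N. \<forall>g. agree N f g \<longrightarrow> (\<forall>x\<in>X. P x g)"
  using assms
proof (induction X rule: finite_induct)
  case (insert x X)
  then obtain N M where "\<forall>g. agree N f g \<longrightarrow> (\<forall>x\<in>X. P x g)" "\<forall>g. agree M f g \<longrightarrow> P x g"
    by auto
  then have "\<forall>g. agree (max N M) f g \<longrightarrow> (\<forall>x\<in>insert x X. P x g)"
    by (metis agree_mono insert_iff max.cobounded1 max.cobounded2)
  then show ?case ..
qed simp

text \<open>The use principle: a halting computation has finitely many subcomputations, also under
  \<open>Mu\<close>, so \<open>N\<close> can be taken past all its oracle queries.\<close>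

lemma computes_use:
  "computes f p xs y \<Longrightarrow> \<exists>N. \<forall>g. agree N f g \<longrightarrow> computes g p xs y"
proof (induction rule: computes.induct)
  case (Zero xs)
  then show ?case by (auto intro: computes.Zero)
next
  case (Succ x)
  then show ?case by (auto intro: computes.Succ)
next
  case (Oracle x)
  have "computes g Oracle [x] (f x)" if "agree (Suc x) f g" for g
    using computes.Oracle[of g x] that by (simp add: agree_def)
  then show ?case by blast
next
  case (Proj i xs)
  then show ?case by (auto intro: computes.Proj)
next
  case (Comp xs qs ys p z)
  have len: "length qs = length ys"
    using Comp.IH(1) by (rule list_all2_lengthD)
  have "\<forall>i\<in>{..<length qs}. \<exists>N. \<forall>g. agree N f g \<longrightarrow> computes g (qs ! i) xs (ys ! i)"
    using list_all2_nthD[OF Comp.IH(1)] by blast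
  from finite_uniform_agree_bound[OF _ this] obtain N
    where N: "\<And>g. agree N f g \<Longrightarrow> \<forall>i\<in>{..<length qs}. computes g (qs ! i) xs (ys ! i)"
    by auto
  obtain M where M: "\<And>g. agree M f g \<Longrightarrow> computes g p ys z"
    using Comp.IH(2) by auto
  have "computes g (Comp p qs) xs z" if "agree (max N M) f g" for g
  proof (rule computes.Comp)
    show "list_all2 (\<lambda>q y. computes g q xs y) qs ys"
      using N[of g] agree_mono[OF that] len by (auto simp: list_all2_conv_all_nth)
    show "computes g p ys z"
      using M agree_mono[OF that] by simp
  qed
  then show ?case by blast
next
  case (PrimRec_0 p xs y q)
  then show ?case by (blast intro: computes.PrimRec_0)
next
  case (PrimRec_Suc p q n xs y z)
  then obtain N M where "\<And>g. agree N f g \<Longrightarrow> computes g (PrimRec p q) (n # xs) y"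
    "\<And>g. agree M f g \<Longrightarrow> computes g q (n # y # xs) z"
    by auto
  then have "\<forall>g. agree (max N M) f g \<longrightarrow> computes g (PrimRec p q) (Suc n # xs) z"
    by (meson agree_mono computes.PrimRec_Suc max.cobounded1 max.cobounded2)
  then show ?case ..
next
  case (Mu p n xs)
  have "\<forall>m\<in>{..<n}. \<exists>N. \<forall>g. agree N f g \<longrightarrow> (\<exists>y. computes g p (m # xs) (Suc y))"
    using Mu.IH(2) by (meson lessThan_iff)
  from finite_uniform_agree_bound[OF _ this] obtain N
    where N: "\<And>g. agree N f g \<Longrightarrow> \<forall>m\<in>{..<n}. \<exists>y. computes g p (m # xs) (Suc y)"
    by auto
  obtain M where M: "\<And>g. agree M f g \<Longrightarrow> computes g p (n # xs) 0"
    using Mu.IH(1) by auto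
  have "computes g (Mu p) xs n" if "agree (max N M) f g" for g
    using M[of g] N[of g] agree_mono[OF that] by (intro computes.Mu) auto
  then show ?case by blast
qed

text \<open>A finite part of the oracle fixes a single output value but not totality of the output,
  hence the proviso \<open>\<Phi> g = Some k\<close>.\<close>

lemma turing_functional_continuous:
  assumes "turing_functional \<Phi>" and "\<Phi> f = Some h"
  shows "\<exists>N. \<forall>g k. agree N f g \<longrightarrow> \<Phi> g = Some k \<longrightarrow> k n = h n"
proof -
  obtain p where p: "\<And>f g. \<Phi> f = Some g \<longleftrightarrow> (\<forall>n. computes f p [n] (g n))"
    using assms(1) unfolding turing_functional_def by blast
  then obtain N where "\<forall>g. agree N f g \<longrightarrow> computes g p [n] (h n)"
    using assms(2) computes_use by blast
  then show ?thesis
    using p computes_deterministic by blast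
qed

section \<open>Ascending and descending sequences\<close>

lemma descending_eq_ascending_converse: "descending R S \<longleftrightarrow> ascending (R\<inverse>) S"
  by (simp add: descending_def ascending_def)

lemma chain_less:
  assumes "trans R" and "\<And>n. (x n, x (Suc n)) \<in> R" and "m < n"
  shows "(x m, x n) \<in> R"
  using \<open>m < n\<close>
proof (induction n)
  case (Suc n)
  then show ?case
    using assms(2)[of n] transD[OF assms(1)] by (cases "m = n") auto
qed simp

text \<open>A chain of \<open>R\<close> need not increase numerically. Its records, the terms
  exceeding all earlier ones, do, and there are infinitely many since an injective sequence is
  unbounded.\<close>

lemma ascending_subset_of_chain:
  fixes x :: "nat \<Rightarrow> nat"
  assumes "trans R" "irrefl R" and chain: "\<And>n. (x n, x (Suc n)) \<in> R"
  obtains S where "S \<subseteq> range x" "infinite S" "ascending R S"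
proof -
  have less: "(x m, x n) \<in> R" if "m < n" for m n
    using chain_less[of R x, OF assms(1) chain that] .
  have "inj x"
    using less assms(2) by (intro linorder_injI) (metis irrefl_def)
  then have "infinite (range x)"
    by (rule range_inj_infinite)
  then have unb: "\<exists>n. B < x n" for B
    unfolding infinite_nat_iff_unbounded by auto
  define S where "S = {x n | n. \<forall>m<n. x m < x n}"
  have "\<exists>s>B. s \<in> S" for B
  proof -
    obtain n where n: "B < x n" "\<forall>m<n. \<not> B < x m"
      using exists_least_iff[of "\<lambda>n. B < x n"] unb[of B] by blast
    then have "\<forall>m<n. x m < x n"
      by (meson not_less order_le_less_trans)
    then have "x n \<in> S"
      unfolding S_def by blast
    with n(1) show ?thesis by blast
  qed
  then have "infinite S"
    using infinite_nat_iff_unbounded by blast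
  moreover have "ascending R S"
    unfolding ascending_def
  proof (intro ballI impI)
    fix s t assume "s \<in> S" "t \<in> S" "s < t"
    then obtain m n where "s = x m" "t = x n" "\<forall>l<m. x l < x m"
      unfolding S_def by blast
    then show "(s, t) \<in> R"
      using less[of m n] \<open>s < t\<close> by (metis linorder_neqE_nat less_asym)
  qed
  ultimately show thesis
    using that[of S] by (auto simp: S_def)
qed

section \<open>The abstract forcing argument\<close>

text \<open>A forcing condition with stem \<open>c\<close> below \<open>N\<close> and reservoir
  \<open>A\<close>. The stem may contain colours outside \<open>A\<close>, so avoiding a colour
  means using it finitely often.\<close>

definition extensions :: "baire \<Rightarrow> nat \<Rightarrow> nat set \<Rightarrow> baire set" where
  "extensions c N A = {c'. agree N c c' \<and> (\<forall>m\<ge>N. c' m \<in> A)}"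

lemma extensions_nonempty:
  assumes "A \<noteq> {}"
  shows "\<exists>c'. c' \<in> extensions c N A"
proof -
  obtain a where "a \<in> A" using assms by blast
  then have "(\<lambda>m. if m < N then c m else a) \<in> extensions c N A"
    by (auto simp: extensions_def agree_def)
  then show ?thesis by blast
qed

lemma extensions_trans:
  assumes "c' \<in> extensions c N A" "c'' \<in> extensions c' N' A'" "N \<le> N'" "A' \<subseteq> A"
  shows "c'' \<in> extensions c N A"
  using assms unfolding extensions_def agree_def by simp (metis leI order_less_le_trans subsetD)

lemma extensions_avoid_finite:
  assumes "c' \<in> extensions c N A" "i \<notin> A"
  shows "finite {m. c' m = i}"
proof (rule finite_subset)
  show "{m. c' m = i} \<subseteq> {..<N}"
    using assms by (auto simp: extensions_def) (meson not_le)
qed simp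

lemma card_Diff_singleton_ge: "n < card A \<Longrightarrow> n \<le> card (A - {i})"
  using diff_card_le_card_Diff[of "{i}" A] by simp

text \<open>The flag \<open>d\<close> distinguishes ascending (\<open>True\<close>) from descending (\<open>False\<close>) sequences.\<close>

definition directed :: "bool \<Rightarrow> (nat \<times> nat) set \<Rightarrow> (nat \<times> nat) set" where
  "directed d R = (if d then R else R\<inverse>)"

definition monotone_seq :: "bool \<Rightarrow> nat set \<Rightarrow> (nat \<times> nat) set \<Rightarrow> nat set \<Rightarrow> bool" where
  "monotone_seq d L R S \<longleftrightarrow> S \<subseteq> L \<and> infinite S \<and> ascending (directed d R) S"

text \<open>Quantifying over all \<open>c'\<close> makes commitment a property of the string below
  \<open>N\<close>, so it survives extension. Membership of \<open>x\<close> lets totality compare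
  it with the elements of a sequence.\<close>

definition committed ::
    "nat set \<Rightarrow> (baire \<Rightarrow> nat set) \<Rightarrow> (baire \<Rightarrow> (nat \<times> nat) set)
      \<Rightarrow> bool \<Rightarrow> baire \<Rightarrow> nat \<Rightarrow> nat \<Rightarrow> nat \<Rightarrow> bool" where
  "committed K L R d c N x i \<longleftrightarrow>
     (\<forall>c'. range c' \<subseteq> K \<longrightarrow> agree N c c' \<longrightarrow>
        x \<in> L c' \<and>
        (\<forall>S. monotone_seq d (L c') (R c') S \<longrightarrow> (\<forall>s\<in>S. (x, s) \<in> directed d (R c'))
          \<longrightarrow> infinite {m. c' m = i}))"

text \<open>What is retained of a reduction: \<open>L c\<close> and \<open>R c\<close> form the
  order coded by \<Phi>(c), and \<Psi> enters only through \<open>commits\<close>.\<close>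

locale committing_orders =
  fixes K :: "nat set" and L :: "baire \<Rightarrow> nat set" and R :: "baire \<Rightarrow> (nat \<times> nat) set"
  assumes order: "range c \<subseteq> K \<Longrightarrow> infinite_linear_order (L c) (R c)"
    and R_continuous: "range c \<subseteq> K \<Longrightarrow> (x, y) \<in> R c \<Longrightarrow>
      \<exists>N. \<forall>c'. range c' \<subseteq> K \<longrightarrow> agree N c c' \<longrightarrow> (x, y) \<in> R c'"
    and commits: "range c \<subseteq> K \<Longrightarrow> monotone_seq d (L c) (R c) S \<Longrightarrow>
      \<exists>x\<in>S. \<exists>i N. committed K L R d c N x i"
begin

abbreviation Q :: "bool \<Rightarrow> baire \<Rightarrow> (nat \<times> nat) set" where
  "Q d c \<equiv> directed d (R c)"

abbreviation seq :: "bool \<Rightarrow> baire \<Rightarrow> nat set \<Rightarrow> bool" where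
  "seq d c S \<equiv> monotone_seq d (L c) (R c) S"

abbreviation com :: "bool \<Rightarrow> baire \<Rightarrow> nat \<Rightarrow> nat \<Rightarrow> nat \<Rightarrow> bool" where
  "com \<equiv> committed K L R"

lemma Q_order:
  assumes "range c \<subseteq> K"
  shows "trans (Q d c)" "irrefl (Q d c)" "total_on (L c) (Q d c)" "Q d c \<subseteq> L c \<times> L c"
  using order[OF assms]
  by (auto simp: infinite_linear_order_def strict_linear_order_on_def directed_def irrefl_def)

lemma Q_continuous:
  assumes "range c \<subseteq> K" "(x, y) \<in> Q d c"
  shows "\<exists>N. \<forall>c'. range c' \<subseteq> K \<longrightarrow> agree N c c' \<longrightarrow> (x, y) \<in> Q d c'"
  using assms R_continuous by (cases d) (auto simp: directed_def)

lemma seq_exists: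
  assumes "range c \<subseteq> K"
  shows "\<exists>S. seq d c S \<or> seq (\<not> d) c S"
proof -
  from ADS_solvable[OF order[OF assms]] obtain S where "S \<subseteq> L c" "infinite S"
    "ascending (R c) S \<or> descending (R c) S"
    by blast
  then show ?thesis
    by (auto simp: monotone_seq_def directed_def descending_eq_ascending_converse)
qed

lemma seq_of_chain:
  assumes "range c \<subseteq> K" and "\<And>n. (x n, x (Suc n)) \<in> Q d c"
  obtains S where "S \<subseteq> range x" "seq d c S"
proof -
  obtain S where S: "S \<subseteq> range x" "infinite S" "ascending (Q d c) S"
    using ascending_subset_of_chain[of "Q d c" x, OF Q_order(1,2)[OF assms(1)] assms(2)] by blast
  moreover have "range x \<subseteq> L c"
    using assms(2) Q_order(4)[OF assms(1)] by blast
  ultimately show thesis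
    using that unfolding monotone_seq_def by blast
qed

lemma com_mono:
  assumes "com d c N x i" "N \<le> M" "agree N c c'"
  shows "com d c' M x i"
  using assms unfolding committed_def by (meson agree_mono agree_trans)

text \<open>An element of \<open>S\<close> above \<open>x\<close> would put a whole tail of
  \<open>S\<close> above \<open>x\<close>, which the commitment forbids when \<open>i\<close> is
  used finitely often.\<close>

lemma seq_below_committed:
  assumes com: "com d c N x i" and "agree N c c'" "range c' \<subseteq> K" and fin: "finite {m. c' m = i}"
    and S: "seq d c' S" and s: "s \<in> S"
  shows "(s, x) \<in> Q d c'"
proof -
  note Q = Q_order[OF assms(3), of d]
  have tail: "infinite (S \<inter> {t. s < t})" for s
    using S unfolding monotone_seq_def
    by (metis Int_Collect infinite_nat_iff_unbounded Collect_mem_eq IntI max.strict_boundedE mem_Collect_eq)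
  have x: "x \<in> L c'"
    using assms(1-3) by (auto simp: committed_def)
  have not_above: "(x, s) \<notin> Q d c'" if "s \<in> S" for s
  proof
    assume xs: "(x, s) \<in> Q d c'"
    define T where "T = S \<inter> {t. s < t}"
    have "seq d c' T"
      using S tail[of s] by (auto simp: monotone_seq_def T_def ascending_def)
    moreover have "(x, t) \<in> Q d c'" if "t \<in> T" for t
      using that \<open>s \<in> S\<close> S xs transD[OF Q(1)]
      by (auto simp: T_def monotone_seq_def ascending_def)
    ultimately show False
      using assms(1-3) fin unfolding committed_def by blast
  qed
  \<comment> \<open>Rules out \<open>s = x\<close>: the later element \<open>t\<close> would then
    lie above \<open>x\<close>.\<close>
  obtain t where "t \<in> S" "s < t"
    using tail[of s] by (metis Collect_empty_eq Int_Collect finite.emptyI disjoint_iff mem_Collect_eq)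
  then have "(s, t) \<in> Q d c'"
    using S s by (auto simp: monotone_seq_def ascending_def)
  then have "s \<noteq> x"
    using not_above[OF \<open>t \<in> S\<close>] by auto
  then show ?thesis
    using not_above[OF s] Q(3) x s S unfolding total_on_def monotone_seq_def by blast
qed

lemma range_extensions:
  assumes "range c \<subseteq> K" "A \<subseteq> K" "c' \<in> extensions c N A"
  shows "range c' \<subseteq> K"
proof
  fix y assume "y \<in> range c'"
  then obtain m where "y = c' m" by blast
  moreover have "c' m = c m \<or> c' m \<in> A"
    using assms(3) by (cases "m < N") (auto simp: extensions_def agree_def)
  ultimately show "y \<in> K"
    using assms(1,2) by auto
qed

text \<open>A fusion argument: each stage avoids the current \<open>i\<close>, so that a new
  committed element falls below \<open>x\<close>. The avoidance is temporary, because a finite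
  string already secures the relation; the limit may use all of \<open>A\<close>.\<close>

lemma committed_chain:
  assumes c0: "range c0 \<subseteq> K" and A: "A \<subseteq> K" and com0: "com d c0 N0 x0 i0"
    and ex: "\<And>c N i. c \<in> extensions c0 N0 A \<Longrightarrow> N0 \<le> N
      \<Longrightarrow> \<exists>c' \<in> extensions c N (A - {i}). \<exists>S. seq d c' S"
    and c0A: "c0 \<in> extensions c0 N0 A"
  obtains c x where "c \<in> extensions c0 N0 A" "x 0 = x0" "\<And>n. (x (Suc n), x n) \<in> Q d c"
    "\<And>n. \<exists>N i. com d c N (x n) i"
proof -
  define P where "P = (\<lambda>(c, N, x, i). c \<in> extensions c0 N0 A \<and> N0 \<le> N \<and> com d c N x i)"
  define step where "step = (\<lambda>(c, N, x, i :: nat) (c', N', x', i' :: nat).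
    agree N c c' \<and> N < N' \<and>
    (\<forall>c''. range c'' \<subseteq> K \<longrightarrow> agree N' c' c'' \<longrightarrow> (x', x) \<in> Q d c''))"
  have next_state: "\<exists>t. P t \<and> step s t" if "P s" for s
  proof -
    obtain c N x i where s: "s = (c, N, x, i)" by (cases s)
    have c: "c \<in> extensions c0 N0 A" "N0 \<le> N" and com: "com d c N x i"
      using that by (auto simp: P_def s)
    obtain c' S where c': "c' \<in> extensions c N (A - {i})" and S: "seq d c' S"
      using ex[OF c] by blast
    have c'A: "c' \<in> extensions c0 N0 A"
      using extensions_trans[OF c(1) c' c(2)] by blast
    have K: "range c' \<subseteq> K"
      using range_extensions[OF c0 A c'A] .
    have agr: "agree N c c'"
      using c' by (simp add: extensions_def)
    have fin: "finite {m. c' m = i}"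
      using extensions_avoid_finite[OF c'] by blast
    obtain x' i' M where x': "x' \<in> S" and com': "com d c' M x' i'"
      using commits[OF K S] by blast
    have "(x', x) \<in> Q d c'"
      using seq_below_committed[OF com agr K fin S x'] .
    then obtain M' where M': "\<forall>c''. range c'' \<subseteq> K \<longrightarrow> agree M' c' c'' \<longrightarrow> (x', x) \<in> Q d c''"
      using Q_continuous[OF K] by blast
    \<comment> \<open>\<open>Suc N\<close> makes the lengths strictly increase, so that every value
      is decided in the limit.\<close>
    define N' where "N' = Suc N + M + M'"
    have "com d c' N' x' i'"
      by (rule com_mono[OF com']) (simp_all add: N'_def)
    then have "P (c', N', x', i')"
      using c'A c(2) by (simp add: P_def N'_def)
    moreover have "step s (c', N', x', i')"
      unfolding step_def s using agr M' by (auto simp: N'_def dest: agree_mono[where M = M'])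
    ultimately show ?thesis by blast
  qed
  have init: "P (c0, N0, x0, i0)"
    using c0A com0 by (simp add: P_def)
  obtain f where f0: "f 0 = (c0, N0, x0, i0)" and fP: "\<And>n. P (f n)"
    and fstep: "\<And>n. step (f n) (f (Suc n))"
    using dependent_nat_choice[of "\<lambda>n s. P s \<and> (n = 0 \<longrightarrow> s = (c0, N0, x0, i0))" "\<lambda>_. step"]
      init next_state by (metis nat.distinct(1))
  define C where "C n = fst (f n)" for n
  define M where "M n = fst (snd (f n))" for n
  define X where "X n = fst (snd (snd (f n)))" for n
  define I where "I n = snd (snd (snd (f n)))" for n
  have f: "f n = (C n, M n, X n, I n)" for n
    by (simp add: C_def M_def X_def I_def)
  have CA: "C n \<in> extensions c0 N0 A" and MN: "N0 \<le> M n" and XI: "com d (C n) (M n) (X n) (I n)" for n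
    using fP[of n] by (auto simp: P_def f)
  have agr: "agree (M n) (C n) (C (Suc n))" and M_less: "M n < M (Suc n)"
    and X_step: "\<And>c''. range c'' \<subseteq> K \<Longrightarrow> agree (M (Suc n)) (C (Suc n)) c''
      \<Longrightarrow> (X (Suc n), X n) \<in> Q d c''" for n
    using fstep[of n] by (auto simp: step_def f)
  have "strict_mono M"
    using M_less by (rule strict_mono_Suc_iff[THEN iffD2, rule_format])
  have agr_le: "agree (M n) (C n) (C m)" if "n \<le> m" for n m
    using that
  proof (induction m rule: dec_induct)
    case (step m)
    then show ?case
      using agree_trans agree_mono[OF agr] strict_mono_less_eq[OF \<open>strict_mono M\<close>] by blast
  qed simp
  have M_ge: "m < M (Suc m)" for m
    using strict_mono_imp_increasing[OF \<open>strict_mono M\<close>, of "Suc m"] by simp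
  \<comment> \<open>Stage \<open>Suc m\<close> fixes a string longer than \<open>m\<close>, so this
    value never changes afterwards.\<close>
  define c where "c m = C (Suc m) m" for m
  have c_agr: "agree (M n) (C n) c" for n
    unfolding agree_def
  proof (intro allI impI)
    fix m assume m: "m < M n"
    show "C n m = c m"
      using agr_le[of n "Suc m"] agr_le[of "Suc m" n] m M_ge[of m]
      unfolding agree_def c_def by (metis nat_le_linear)
  qed
  have cA: "c \<in> extensions c0 N0 A"
    using CA unfolding extensions_def agree_def c_def by simp
  have K: "range c \<subseteq> K"
    using range_extensions[OF c0 A cA] .
  show thesis
  proof
    show "c \<in> extensions c0 N0 A" by fact
    show "X 0 = x0" using f0 by (simp add: f)
    show "(X (Suc n), X n) \<in> Q d c" for n
      using X_step[OF K c_agr] .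
    show "\<exists>N i. com d c N (X n) i" for n
      using com_mono[OF XI order_refl c_agr] by blast
  qed
qed

text \<open>Otherwise all extensions carry sequences in direction \<open>\<not> d\<close>, even with
  one of the colours dropped, and \<open>committed_chain\<close> for \<open>\<not> d\<close> yields
  a chain that ascends in direction \<open>d\<close>.\<close>

lemma extension_with_seq:
  assumes c0: "range c0 \<subseteq> K" and A: "A \<subseteq> K" "2 \<le> card A"
  shows "\<exists>c \<in> extensions c0 N0 A. \<exists>S. seq d c S"
proof (rule ccontr)
  assume no: "\<not> ?thesis"
  have dual: "\<exists>S. seq (\<not> d) c S" if "c \<in> extensions c0 N0 A" for c
    using no seq_exists[OF range_extensions[OF c0 A(1) that], of d] that by blast
  have "A \<noteq> {}"
    using A(2) by auto
  then obtain c1 where c1: "c1 \<in> extensions c0 N0 A"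
    using extensions_nonempty by blast
  have K1: "range c1 \<subseteq> K"
    using range_extensions[OF c0 A(1) c1] .
  obtain S x1 i1 N where com: "com (\<not> d) c1 N x1 i1"
    using dual[OF c1] commits[OF K1] by blast
  define N1 where "N1 = max N0 N"
  have com1: "com (\<not> d) c1 N1 x1 i1"
    by (rule com_mono[OF com]) (simp_all add: N1_def)
  have c1A: "c1 \<in> extensions c1 N1 A"
    using c1 by (simp add: extensions_def N1_def)
  have sub: "c \<in> extensions c0 N0 A" if "c \<in> extensions c1 N1 A" for c
    using extensions_trans[OF c1 that] by (simp add: N1_def)
  have step: "\<exists>c' \<in> extensions c N (A - {i}). \<exists>S. seq (\<not> d) c' S"
    if "c \<in> extensions c1 N1 A" "N1 \<le> N" for c N i
  proof -
    have "1 \<le> card (A - {i})"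
      using card_Diff_singleton_ge[of 1 A i] A(2) by simp
    then have "A - {i} \<noteq> {}"
      by (metis card.empty not_one_le_zero)
    then obtain c' where c': "c' \<in> extensions c N (A - {i})"
      using extensions_nonempty by blast
    then have "c' \<in> extensions c1 N1 A"
      using extensions_trans[OF that(1) c' that(2)] by blast
    then show ?thesis
      using dual[OF sub] c' by blast
  qed
  obtain c x where c: "c \<in> extensions c1 N1 A" and x: "\<And>n. (x (Suc n), x n) \<in> Q (\<not> d) c"
    using committed_chain[OF K1 A(1) com1 step c1A] by blast
  have "(x n, x (Suc n)) \<in> Q d c" for n
    using x[of n] by (simp add: directed_def split: if_splits)
  then show False
    using seq_of_chain[of c x d, OF range_extensions[OF c0 A(1) sub[OF c]]] no sub[OF c] by blast
qed

text \<open>\<open>committed_chain\<close> drops one of three colours and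
  \<open>extension_with_seq\<close> uses the two left. Both \<open>x\<close> and \<open>y\<close>
  are taken from the resulting chain, \<open>x\<close> as the successor of \<open>y\<close>.\<close>

lemma split_pair:
  assumes "3 \<le> card K"
  obtains c N x y a b where "range c \<subseteq> K" "com True c N x a" "com False c N y b" "(x, y) \<in> R c"
proof -
  have card: "2 \<le> card K" and card': "2 \<le> card (K - {i})" for i
    using assms card_Diff_singleton_ge[of 2 K] by auto
  obtain k where "k \<in> K"
    using card by fastforce
  then have k: "range (\<lambda>_ :: nat. k) \<subseteq> K" by auto
  obtain c0 S where c0: "c0 \<in> extensions (\<lambda>_. k) 0 K" "seq True c0 S"
    using extension_with_seq[OF k order_refl card] by blast
  have K0: "range c0 \<subseteq> K"
    using range_extensions[OF k order_refl c0(1)] .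
  obtain x0 i0 N0 where com0: "com True c0 N0 x0 i0"
    using commits[OF K0 c0(2)] by blast
  have c0K: "c0 \<in> extensions c0 N0 K"
    using K0 by (auto simp: extensions_def)
  have step: "\<exists>c' \<in> extensions c N (K - {i}). \<exists>S. seq True c' S"
    if "c \<in> extensions c0 N0 K" for c N i
    using extension_with_seq[OF range_extensions[OF K0 order_refl that] Diff_subset card'] .
  obtain c x where c: "c \<in> extensions c0 N0 K" and x: "\<And>n. (x (Suc n), x n) \<in> Q True c"
    and com: "\<And>n. \<exists>N i. com True c N (x n) i"
    using committed_chain[OF K0 order_refl com0 step c0K] by blast
  have K: "range c \<subseteq> K"
    using range_extensions[OF K0 order_refl c] .
  obtain S where S: "S \<subseteq> range x" "seq False c S"
    using seq_of_chain[OF K, of x False] x by (auto simp: directed_def)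
  obtain y b M where y: "y \<in> S" "com False c M y b"
    using commits[OF K S(2)] by blast
  obtain n where n: "y = x n"
    using y(1) S(1) by blast
  obtain N a where a: "com True c N (x (Suc n)) a"
    using com by blast
  show thesis
  proof
    show "range c \<subseteq> K" by fact
    show "com True c (max N M) (x (Suc n)) a"
      by (rule com_mono[OF a]) simp_all
    show "com False c (max N M) y b"
      by (rule com_mono[OF y(2)]) simp_all
    show "(x (Suc n), y) \<in> R c"
      using x[of n] by (simp add: n directed_def)
  qed
qed

theorem card_colours_less_5: "card K < 5"
proof (rule ccontr)
  assume "\<not> card K < 5"
  then have card: "5 \<le> card K" by simp
  obtain c0 N x0 y a b where K0: "range c0 \<subseteq> K" and comx: "com True c0 N x0 a"
    and comy: "com False c0 N y b" and xy: "(x0, y) \<in> R c0"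
    by (rule split_pair) (use card in auto)
  obtain M where M: "\<And>c'. range c' \<subseteq> K \<Longrightarrow> agree M c0 c' \<Longrightarrow> (x0, y) \<in> R c'"
    using R_continuous[OF K0 xy] by blast
  \<comment> \<open>Of five colours three remain; \<open>committed_chain\<close> drops one more and
    two are left for \<open>extension_with_seq\<close>.\<close>
  define A where "A = K - {a} - {b}"
  have A: "A \<subseteq> K" "b \<notin> A"
    by (auto simp: A_def)
  have "3 \<le> card A"
    unfolding A_def using card card_Diff_singleton_ge[of 4 K a] card_Diff_singleton_ge[of 3 "K - {a}" b]
    by simp
  then have card': "2 \<le> card (A - {i})" for i
    using card_Diff_singleton_ge[of 2 A i] by simp
  then have "A \<noteq> {}"
    by fastforce
  \<comment> \<open>The length \<open>max N M\<close> preserves both commitments and the relation of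
    \<open>x0\<close> to \<open>y\<close>.\<close>
  then obtain c1 where c1: "c1 \<in> extensions c0 (max N M) A"
    using extensions_nonempty by blast
  have K1: "range c1 \<subseteq> K"
    using range_extensions[OF K0 A(1) c1] .
  have agr1: "agree (max N M) c0 c1"
    using c1 by (simp add: extensions_def)
  have comx1: "com True c1 (max N M) x0 a"
    using com_mono[OF comx _ agree_mono[OF agr1]] by simp
  have c1A: "c1 \<in> extensions c1 (max N M) A"
    using c1 by (simp add: extensions_def)
  have step: "\<exists>c' \<in> extensions c N' (A - {i}). \<exists>S. seq True c' S"
    if "c \<in> extensions c1 (max N M) A" for c N' i
    using extension_with_seq[OF range_extensions[OF K1 A(1) that] _ card'] A(1) by blast
  obtain c x where c: "c \<in> extensions c1 (max N M) A" and x0: "x 0 = x0"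
    and x: "\<And>n. (x (Suc n), x n) \<in> Q True c"
    using committed_chain[OF K1 A(1) comx1 step c1A] by blast
  have K: "range c \<subseteq> K"
    using range_extensions[OF K1 A(1) c] .
  have agr: "agree (max N M) c0 c"
    using c agr1 agree_trans by (auto simp: extensions_def)
  have chain: "(x n, x (Suc n)) \<in> Q False c" for n
    using x[of n] by (simp add: directed_def)
  obtain S where S: "S \<subseteq> range x" "seq False c S"
    using seq_of_chain[of c x False, OF K chain] by blast
  \<comment> \<open>In the reversed order the chain starts above \<open>y\<close> and moves up, so
    the commitment of \<open>y\<close> forces \<open>b\<close> infinitely often.\<close>
  have yx: "(y, x 0) \<in> Q False c"
    using M[OF K agree_mono[OF agr]] by (simp add: x0 directed_def)
  have "(y, x n) \<in> Q False c" for n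
    using yx chain_less[of "Q False c" x 0 n, OF Q_order(1)[OF K] chain] transD[OF Q_order(1)[OF K] yx]
    by (cases "n = 0") auto
  then have "\<forall>s\<in>S. (y, s) \<in> Q False c"
    using S(1) by blast
  then have "infinite {m. c m = b}"
    using comy K agree_mono[OF agr] S(2) unfolding committed_def by simp
  then show False
    using extensions_avoid_finite[OF c A(2)] by simp
qed

end

section \<open>Application to Weihrauch reductions\<close>

lemma ADS_code_order:
  assumes "infinite_linear_order L R"
  shows "char_fun S \<in> ADS (code_order L R) \<longleftrightarrow>
    S \<subseteq> L \<and> infinite S \<and> (ascending R S \<or> descending R S)"
  using assms by (auto simp: ADS_def code_order_inject char_fun_inject)

lemma code_order_mem:
  "code_order L R (2 * n) = 1 \<longleftrightarrow> n \<in> L"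
  "code_order L R (Suc (2 * prod_encode (x, y))) = 1 \<longleftrightarrow> (x, y) \<in> R"
  by (auto simp: code_order_def join_def char_fun_def)

lemma agree_join:
  assumes "agree N f f'" "agree N g g'"
  shows "agree N (join f g) (join f' g')"
  using assms by (auto simp: agree_def join_def)

lemma RT1_not_le_ADS:
  assumes "5 \<le> k"
  shows "\<not> RT1 k \<le>\<^sub>W ADS"
proof
  assume "RT1 k \<le>\<^sub>W ADS"
  then obtain \<Phi> \<Psi> where tf: "turing_functional \<Phi>" "turing_functional \<Psi>"
    and \<Phi>: "\<And>c. c \<in> dom_of (RT1 k) \<Longrightarrow> \<exists>h \<in> dom_of ADS. \<Phi> c = Some h"
    and \<Psi>: "\<And>c g. c \<in> dom_of (RT1 k) \<Longrightarrow> g \<in> ADS (the (\<Phi> c))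
      \<Longrightarrow> \<exists>h \<in> RT1 k c. \<Psi> (join c g) = Some h"
    unfolding weihrauch_le_def by metis
  have "\<exists>L R. \<Phi> c = Some (code_order L R) \<and> infinite_linear_order L R" if "range c \<subseteq> {..<k}" for c
    using \<Phi>[of c] that by (auto simp: dom_of_RT1 dom_of_ADS)
  then obtain L R where LR: "\<And>c. range c \<subseteq> {..<k} \<Longrightarrow>
      \<Phi> c = Some (code_order (L c) (R c)) \<and> infinite_linear_order (L c) (R c)"
    by metis
  have sol: "\<exists>H. \<Psi> (join c (char_fun S)) = Some (char_fun H) \<and> infinite H \<and> (\<exists>i. \<forall>x\<in>H. c x = i)"
    if "range c \<subseteq> {..<k}" "monotone_seq d (L c) (R c) S" for c d S
  proof -
    have "char_fun S \<in> ADS (the (\<Phi> c))"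
      using LR[OF that(1)] that(2)
      by (auto simp: ADS_code_order monotone_seq_def directed_def descending_eq_ascending_converse
          split: if_splits)
    then show ?thesis
      using \<Psi>[of c] that(1) by (fastforce simp: dom_of_RT1 RT1_def)
  qed
  have code_cont: "\<exists>N. \<forall>c'. agree N c c' \<longrightarrow> range c' \<subseteq> {..<k} \<longrightarrow>
      code_order (L c') (R c') n = code_order (L c) (R c) n" if "range c \<subseteq> {..<k}" for c n
    using turing_functional_continuous[OF tf(1), of c _ n] LR that by metis
  have R_cont: "\<exists>N. \<forall>c'. agree N c c' \<longrightarrow> range c' \<subseteq> {..<k} \<longrightarrow> (x, y) \<in> R c'"
    if "range c \<subseteq> {..<k}" "(x, y) \<in> R c" for c x y
    using code_cont[OF that(1), of "Suc (2 * prod_encode (x, y))"] that(2) code_order_mem(2) by metis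
  have L_cont: "\<exists>N. \<forall>c'. agree N c c' \<longrightarrow> range c' \<subseteq> {..<k} \<longrightarrow> x \<in> L c'"
    if "range c \<subseteq> {..<k}" "x \<in> L c" for c x
    using code_cont[OF that(1), of "2 * x"] that(2) code_order_mem(1) by metis
  interpret committing_orders "{..<k}" L R
  proof
    show "infinite_linear_order (L c) (R c)" if "range c \<subseteq> {..<k}" for c
      using LR[OF that] by simp
    show "\<exists>N. \<forall>c'. range c' \<subseteq> {..<k} \<longrightarrow> agree N c c' \<longrightarrow> (x, y) \<in> R c'"
      if "range c \<subseteq> {..<k}" "(x, y) \<in> R c" for c x y
      using R_cont[OF that] by blast
    \<comment> \<open>Grafting a sequence above \<open>x\<close> onto the part of \<open>S\<close>
      up to \<open>x\<close> gives a solution from which \<Psi> still outputs the same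
      \<open>n\<close>, so the homogeneous output has colour \<open>c n\<close>.\<close>
    show "\<exists>x\<in>S. \<exists>i N. committed {..<k} L R d c N x i"
      if c: "range c \<subseteq> {..<k}" and S: "monotone_seq d (L c) (R c) S" for c d S
    proof -
      obtain H where H: "\<Psi> (join c (char_fun S)) = Some (char_fun H)" "infinite H"
        using sol[OF c S] by blast
      then obtain n where n: "n \<in> H"
        by fastforce
      obtain U where U: "\<And>g h. agree U (join c (char_fun S)) g \<Longrightarrow> \<Psi> g = Some h \<Longrightarrow> h n = char_fun H n"
        using turing_functional_continuous[of \<Psi> _ _ n, OF tf(2) H(1)] by blast
      have "infinite S" and SL: "S \<subseteq> L c" and asc: "ascending (directed d (R c)) S"
        using S by (auto simp: monotone_seq_def)
      \<comment> \<open>Beyond \<open>U\<close>, so that \<open>S\<close> up to \<open>x\<close>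
        fixes all that \<Psi> reads of the solution.\<close>
      then obtain x where x: "x \<in> S" "U < x"
        using infinite_nat_iff_unbounded by blast
      define F where "F = S \<inter> {..x}"
      have "\<forall>z\<in>F. \<exists>N. \<forall>c'. agree N c c' \<longrightarrow> range c' \<subseteq> {..<k} \<longrightarrow> z \<in> L c'"
        using L_cont[OF c] SL by (auto simp: F_def)
      from finite_uniform_agree_bound[OF _ this] obtain N1
        where N1: "\<And>c'. agree N1 c c' \<Longrightarrow> range c' \<subseteq> {..<k} \<Longrightarrow> F \<subseteq> L c'"
        by (auto simp: F_def)
      define E where "E = {(z, w) \<in> F \<times> F. z < w}"
      have "finite E"
        by (rule finite_subset[of _ "F \<times> F"]) (auto simp: E_def F_def)
      moreover have "\<forall>e\<in>E. \<exists>N. \<forall>c'. agree N c c' \<longrightarrow> range c' \<subseteq> {..<k} \<longrightarrow> e \<in> directed d (R c')"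
        using R_cont[OF c] asc by (cases d) (auto simp: E_def F_def ascending_def directed_def)
      ultimately obtain N2
        where N2: "\<And>c'. agree N2 c c' \<Longrightarrow> range c' \<subseteq> {..<k} \<Longrightarrow> E \<subseteq> directed d (R c')"
        using finite_uniform_agree_bound[of E c "\<lambda>e c'. range c' \<subseteq> {..<k} \<longrightarrow> e \<in> directed d (R c')"]
        by (metis subsetI)
      \<comment> \<open>\<open>Suc n\<close> preserves the colour of \<open>n\<close>,
        \<open>U\<close> the part of the colouring read by \<Psi>, \<open>N1\<close> and
        \<open>N2\<close> the membership and monotonicity of \<open>F\<close>.\<close>
      define N where "N = Suc n + U + N1 + N2"
      have "committed {..<k} L R d c N x (c n)"
        unfolding committed_def
      proof (intro allI impI conjI)
        fix c' assume c': "range c' \<subseteq> {..<k}" and agr: "agree N c c'"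
        have FL: "F \<subseteq> L c'" and EQ: "E \<subseteq> directed d (R c')"
          using N1[OF agree_mono[OF agr] c'] N2[OF agree_mono[OF agr] c'] by (simp_all add: N_def)
        then show "x \<in> L c'"
          using x by (auto simp: F_def)
        fix S' assume S': "monotone_seq d (L c') (R c') S'" and above: "\<forall>s\<in>S'. (x, s) \<in> directed d (R c')"
        have tr: "trans (directed d (R c'))"
          using LR[OF c'] by (auto simp: infinite_linear_order_def strict_linear_order_on_def directed_def)
        \<comment> \<open>Cutting \<open>S'\<close> at \<open>x\<close> keeps \<open>T\<close> equal
          to \<open>S\<close> up to \<open>x\<close> and places all new elements numerically after
          \<open>F\<close>.\<close>
        define T where "T = F \<union> (S' - {..x})"
        have FQ: "(z, w) \<in> directed d (R c')" if "z \<in> F" "w \<in> F" "z < w" for z w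
          using EQ that by (auto simp: E_def)
        have "(z, w) \<in> directed d (R c')" if "z \<in> T" "w \<in> T" "z < w" for z w
        proof (cases "w \<in> F")
          case True
          then have "z \<in> F"
            using that by (auto simp: T_def F_def)
          with True show ?thesis
            using FQ that by blast
        next
          case False
          then have w: "w \<in> S'" "x < w"
            using that by (auto simp: T_def)
          show ?thesis
          proof (cases "z \<in> F")
            case True
            have "z = x \<or> (z, x) \<in> directed d (R c')"
              using FQ[OF True, of x] True x(1) by (cases "z < x") (auto simp: F_def)
            then show ?thesis
              using above w transD[OF tr] by blast
          next
            case False
            then show ?thesis
              using S' w that by (auto simp: T_def monotone_seq_def ascending_def)
          qed
        qed
        then have "monotone_seq d (L c') (R c') T"
          using S' FL by (auto simp: T_def monotone_seq_def ascending_def)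
        then obtain H' i where H': "\<Psi> (join c' (char_fun T)) = Some (char_fun H')" "infinite H'"
          "\<forall>m\<in>H'. c' m = i"
          using sol[OF c'] by blast
        have "agree U (char_fun S) (char_fun T)"
          using x(2) by (auto simp: agree_def char_fun_def T_def F_def)
        then have "agree U (join c (char_fun S)) (join c' (char_fun T))"
          using agree_mono[OF agr, of U] by (intro agree_join) (simp_all add: N_def)
        from U[OF this H'(1)] have "n \<in> H'"
          using n by (simp add: char_fun_def split: if_splits)
        moreover have "c' n = c n"
          using agr by (simp add: agree_def N_def)
        ultimately have "H' \<subseteq> {m. c' m = c n}"
          using H'(3) by auto
        then show "infinite {m. c' m = c n}"
          using H'(2) finite_subset by blast
      qed
      with x(1) show ?thesis by blast
    qed
  qed
  show False
    using card_colours_less_5 assms by simp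
qed

text \<open>The same functionals work, as \<open>RT1_finite\<close> has more instances and its
  solutions on the instances of \<open>RT1 k\<close> are solutions there.\<close>

lemma RT1_le_RT1_finite:
  assumes "RT1_finite \<le>\<^sub>W G"
  shows "RT1 k \<le>\<^sub>W G"
proof -
  have dom: "c \<in> dom_of RT1_finite" if "c \<in> dom_of (RT1 k)" for c
    using that finite_subset[of "range c" "{..<k}"] by (auto simp: dom_of_RT1 dom_of_RT1_finite)
  have "RT1_finite c \<subseteq> RT1 k c" if "c \<in> dom_of (RT1 k)" for c
    using that by (auto simp: dom_of_RT1 RT1_def RT1_finite_def)
  moreover obtain \<Phi> \<Psi> where "turing_functional \<Phi>" "turing_functional \<Psi>"
    and "\<forall>f \<in> dom_of RT1_finite. \<exists>h \<in> dom_of G. \<Phi> f = Some h"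
    and "\<forall>f \<in> dom_of RT1_finite. \<forall>g \<in> G (the (\<Phi> f)). \<exists>h \<in> RT1_finite f. \<Psi> (join f g) = Some h"
    using assms unfolding weihrauch_le_def by blast
  ultimately show ?thesis
    unfolding weihrauch_le_def using dom
    by (intro exI[of _ \<Phi>] exI[of _ \<Psi>]) blast
qed

theorem theorem4p23: "\<not> RT1 5 \<le>\<^sub>W ADS \<and> \<not> RT1_finite \<le>\<^sub>W ADS"
  using RT1_not_le_ADS[of 5] RT1_le_RT1_finite[of ADS 5] by blast

end
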